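(* Let $G$ be a finite connected graph with vertices $v_1,\dots,v_n$, let $w:D(G)\to\mathbb{C}$ be a symmetric weight function with $\kappa_w(G)\neq 0$, and let ${\bf W}$ be the weighted matrix of $G$ corresponding to $w$. Let \[ f_w(u,t)=\det\big({\bf I}_n-t{\bf W}+(1-u)t^2({\bf D}_w-(1-u){\bf I}_n)\big). \] Then for every nonzero complex number $t$, \[ \frac{\partial^2 f_w(u,t)}{\partial t^2}\Big|_{(1-1/t,t)}=2t^{n-4}\kappa_w(G)\big(Kf^z_w(t)+nt(2w(G)t-2n+1)\big), \] \[ \frac{\partial^2 f_w(u,t)}{\partial t\,\partial u}\Big|_{(1-1/t,t)}=2t^{n-2}\kappa_w(G)\big((n-w(G)t)(n+1)t-Kf^z_w(t)\big), \] \[ \frac{\partial^2 f_w(u,t)}{\partial u^2}\Big|_{(1-1/t,t)}=2t^{n}\kappa_w(G)\big(Kf^z_w(t)-nt\big). \]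
   Context: $D(G)=\{(u,v),(v,u): uv\in E(G)\}$ is the set of arcs of the symmetric digraph of $G$; for an arc $e=(u,v)$, $o(e)=u$, $e^{-1}=(v,u)$. A weight function $w:D(G)\to\mathbb{C}$ is symmetric if $w(e^{-1})=w(e)$ for all $e$. The weighted matrix ${\bf W}=(w_{ij})$ is the $n\times n$ matrix with $w_{ij}=w(v_i,v_j)$ if $(v_i,v_j)\in D(G)$ and $0$ otherwise. ${\bf D}_w$ is diagonal with entries $d^w_i=\sum_{o(e)=v_i}w(e)$, and ${\bf L}={\bf D}_w-{\bf W}$ is the weighted Laplacian. $w(G)=\sum_{uv\in E(G)}w(u,v)$. The weighted complexity is $\kappa_w(G)=\sum_T\prod_{e\in E(T)}w(e)$ over spanning trees $T$. For $p\neq q$, $r_{pq}=\det({\bf L}^{(pq)})/\kappa_w(G)$, where ${\bf L}^{(pq)}$ is obtained from ${\bf L}$ by deleting rows and columns $p$ and $q$. The weighted Kirchhoff index function is $Kf^z_w(t)=\sum_{1\le p<q\le n}(d^w_pt-2)(d^w_qt-2)r_{pq}$. The notation $|_{(1-1/t,t)}$ means evaluation at $u=1-1/t$ with the same $t$. *)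

theory Defs
  imports
    "HOL-Analysis.Derivative"
    "Jordan_Normal_Form.Determinant"
    "Jordan_Normal_Form.DL_Submatrix"
begin

definition simple_graph :: "'a set \<Rightarrow> 'a set set \<Rightarrow> bool" where
  "simple_graph V E \<longleftrightarrow> finite V \<and> (\<forall>e\<in>E. \<exists>x\<in>V. \<exists>y\<in>V. x \<noteq> y \<and> e = {x, y})"

definition sym_arcs :: "'a set set \<Rightarrow> ('a \<times> 'a) set" where
  "sym_arcs E = {(x, y). {x, y} \<in> E}"

definition connected_graph :: "'a set \<Rightarrow> 'a set set \<Rightarrow> bool" where
  "connected_graph V E \<longleftrightarrow> V \<noteq> {} \<and> (\<forall>x\<in>V. \<forall>y\<in>V. (x, y) \<in> (sym_arcs E)\<^sup>*)"

text \<open>A cycle is given by its cyclic sequence of at least three distinct vertices.\<close>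

definition graph_cycle :: "'a set set \<Rightarrow> 'a list \<Rightarrow> bool" where
  "graph_cycle E xs \<longleftrightarrow> 3 \<le> length xs \<and> distinct xs \<and>
     (\<forall>i<length xs. {xs ! i, xs ! (Suc i mod length xs)} \<in> E)"

definition is_tree :: "'a set \<Rightarrow> 'a set set \<Rightarrow> bool" where
  "is_tree V T \<longleftrightarrow> simple_graph V T \<and> connected_graph V T \<and> \<not> (\<exists>xs. graph_cycle T xs)"

text \<open>A spanning tree of \<open>(V, E)\<close> has vertex set \<open>V\<close> and is represented by its edge set.\<close>

definition spanning_trees :: "'a set \<Rightarrow> 'a set set \<Rightarrow> 'a set set set" where
  "spanning_trees V E = {T. T \<subseteq> E \<and> is_tree V T}"

definition symmetric_weight :: "'a set set \<Rightarrow> ('a \<times> 'a \<Rightarrow> complex) \<Rightarrow> bool" where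
  "symmetric_weight E w \<longleftrightarrow> (\<forall>x y. (x, y) \<in> sym_arcs E \<longrightarrow> w (y, x) = w (x, y))"

text \<open>The weight of an undirected edge is the weight of either of its two arcs; for a
  symmetric weight function the choice of the arc is immaterial.\<close>

definition edge_weight :: "('a \<times> 'a \<Rightarrow> complex) \<Rightarrow> 'a set \<Rightarrow> complex" where
  "edge_weight w e = w (SOME a. {fst a, snd a} = e)"

definition total_weight :: "'a set set \<Rightarrow> ('a \<times> 'a \<Rightarrow> complex) \<Rightarrow> complex" where
  "total_weight E w = (\<Sum>e\<in>E. edge_weight w e)"

definition weighted_complexity :: "'a set \<Rightarrow> 'a set set \<Rightarrow> ('a \<times> 'a \<Rightarrow> complex) \<Rightarrow> complex" where
  "weighted_complexity V E w = (\<Sum>T\<in>spanning_trees V E. \<Prod>e\<in>T. edge_weight w e)"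

definition weighted_degree :: "'a set set \<Rightarrow> ('a \<times> 'a \<Rightarrow> complex) \<Rightarrow> 'a \<Rightarrow> complex" where
  "weighted_degree E w x = (\<Sum>a\<in>{a \<in> sym_arcs E. fst a = x}. w a)"

text \<open>In the following, \<open>v 0, \<dots>, v (n - 1)\<close> enumerates the vertices, so that matrix rows and
  columns are indexed from 0.\<close>

definition weighted_matrix ::
    "'a set set \<Rightarrow> ('a \<times> 'a \<Rightarrow> complex) \<Rightarrow> nat \<Rightarrow> (nat \<Rightarrow> 'a) \<Rightarrow> complex mat" where
  "weighted_matrix E w n v =
     mat n n (\<lambda>(i, j). if (v i, v j) \<in> sym_arcs E then w (v i, v j) else 0)"

definition degree_matrix ::
    "'a set set \<Rightarrow> ('a \<times> 'a \<Rightarrow> complex) \<Rightarrow> nat \<Rightarrow> (nat \<Rightarrow> 'a) \<Rightarrow> complex mat" where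
  "degree_matrix E w n v = mat n n (\<lambda>(i, j). if i = j then weighted_degree E w (v i) else 0)"

definition weighted_laplacian ::
    "'a set set \<Rightarrow> ('a \<times> 'a \<Rightarrow> complex) \<Rightarrow> nat \<Rightarrow> (nat \<Rightarrow> 'a) \<Rightarrow> complex mat" where
  "weighted_laplacian E w n v = degree_matrix E w n v - weighted_matrix E w n v"

definition resistance ::
    "'a set \<Rightarrow> 'a set set \<Rightarrow> ('a \<times> 'a \<Rightarrow> complex) \<Rightarrow> nat \<Rightarrow> (nat \<Rightarrow> 'a) \<Rightarrow> nat \<Rightarrow> nat \<Rightarrow> complex" where
  "resistance V E w n v p q =
     det (submatrix (weighted_laplacian E w n v) ({..<n} - {p, q}) ({..<n} - {p, q}))
       / weighted_complexity V E w"

definition kirchhoff_index_fun ::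
    "'a set \<Rightarrow> 'a set set \<Rightarrow> ('a \<times> 'a \<Rightarrow> complex) \<Rightarrow> nat \<Rightarrow> (nat \<Rightarrow> 'a) \<Rightarrow> complex \<Rightarrow> complex" where
  "kirchhoff_index_fun V E w n v t =
     (\<Sum>(p, q)\<in>{(p, q). p < q \<and> q < n}.
        (weighted_degree E w (v p) * t - 2) * (weighted_degree E w (v q) * t - 2)
          * resistance V E w n v p q)"

definition zeta_det ::
    "'a set set \<Rightarrow> ('a \<times> 'a \<Rightarrow> complex) \<Rightarrow> nat \<Rightarrow> (nat \<Rightarrow> 'a) \<Rightarrow> complex \<Rightarrow> complex \<Rightarrow> complex" where
  "zeta_det E w n v u t =
     det (1\<^sub>m n - t \<cdot>\<^sub>m weighted_matrix E w n v
          + ((1 - u) * t\<^sup>2) \<cdot>\<^sub>m (degree_matrix E w n v - (1 - u) \<cdot>\<^sub>m 1\<^sub>m n))"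

end

theory Submission
  imports Defs
begin

text \<open>
  Put \<open>\<epsilon> = 1 - (1 - u) t\<close>. The matrix defining \<open>f\<^sub>w\<close> equals \<open>t L + \<epsilon> ((2 - \<epsilon>) I - t D)\<close>, and
  \<open>\<epsilon> = 0\<close> at \<open>u = 1 - 1/t\<close>. Expanding the determinant along the diagonal perturbation writes
  \<open>f\<^sub>w\<close> as a polynomial in \<open>\<epsilon>\<close> whose coefficients are combinations of principal minors of \<open>L\<close>:
  the constant term is \<open>det L = 0\<close>, the minors of order \<open>n - 1\<close> are \<open>\<kappa>\<^sub>w\<close> by the matrix-tree
  theorem, and those of order \<open>n - 2\<close> are \<open>\<kappa>\<^sub>w r\<^sub>p\<^sub>q\<close>. Only the coefficients of
  \<open>\<epsilon>\<close> and \<open>\<epsilon>\<^sup>2\<close> contribute to the second derivatives at \<open>\<epsilon> = 0\<close>.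

  For the matrix-tree theorem, every row of the reduced Laplacian is the sum of
  \<open>w(i,k) (e\<^sub>i - e\<^sub>k)\<close> over \<open>k\<close>. By multilinearity its determinant is a sum over functions \<open>f\<close>
  assigning a parent to each non-root vertex, in which \<open>f\<close> contributes its weight if all its
  orbits reach the root, and 0 otherwise. The former functions correspond to the spanning trees.
\<close>

section \<open>Determinants indexed by finite sets\<close>

text \<open>Determinants over arbitrary finite index sets make principal minors and changes of
  indexing painless: deleting rows and columns is just shrinking the set.\<close>

definition det_on :: "'b set \<Rightarrow> ('b \<Rightarrow> 'b \<Rightarrow> 'r::comm_ring_1) \<Rightarrow> 'r" where
  "det_on S A = (\<Sum>p | p permutes S. of_int (sign p) * (\<Prod>i\<in>S. A i (p i)))"

lemma det_on_cong:
  assumes "\<And>i j. i \<in> S \<Longrightarrow> j \<in> S \<Longrightarrow> A i j = B i j"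
  shows "det_on S A = det_on S B"
  unfolding det_on_def
  by (intro sum.cong refl arg_cong2[of _ _ _ _ "(*)"] prod.cong)
     (auto simp: assms permutes_in_image)

text \<open>Conjugation by \<open>h\<close> is a sign-preserving bijection between the permutations
  of the two index sets. This is what moves determinants between matrix positions and
  vertices.\<close>

lemma det_on_image:
  assumes "finite S" "inj_on h S"
  shows "det_on (h ` S) A = det_on S (\<lambda>i j. A (h i) (h j))"
  unfolding det_on_def
proof (rule sum.reindex_bij_witness[symmetric, where i = "map_permutation (h ` S) (inv_into S h)"
        and j = "map_permutation S h"]; clarsimp?)
  note bij = inj_on_imp_bij_betw[OF assms(2)]
  fix p assume p: "p permutes S"
  show "map_permutation (h ` S) (inv_into S h) (map_permutation S h p) = p"
    by (rule map_permutation_compose_inv[OF bij p]) (simp add: assms)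
  show "map_permutation S h p permutes h ` S"
    by (rule map_permutation_permutes[OF bij p])
  show "of_int (sign (map_permutation S h p)) * (\<Prod>i\<in>h ` S. A i (map_permutation S h p i))
      = of_int (sign p) * (\<Prod>i\<in>S. A (h i) (h (p i)))"
    using assms p by (simp add: sign_map_permutation prod.reindex map_permutation_apply)
next
  note bij = inj_on_imp_bij_betw[OF assms(2)]
  fix p assume p: "p permutes h ` S"
  show "map_permutation S h (map_permutation (h ` S) (inv_into S h) p) = p"
    by (rule map_permutation_compose_inv[OF bij_betw_inv_into[OF bij] p]) (auto simp: f_inv_into_f)
  show "map_permutation (h ` S) (inv_into S h) p permutes S"
    by (rule map_permutation_permutes[OF bij_betw_inv_into[OF bij] p])
qed

lemma det_eq_det_on:
  assumes "A \<in> carrier_mat n n"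
  shows "det A = det_on {..<n} (\<lambda>i j. A $$ (i, j))"
  using assms by (simp add: det_on_def det_def' atLeast0LessThan)

text \<open>\<open>pick I\<close> enumerates \<open>I\<close> increasingly, and rows and columns are
  relabelled by this same bijection, so \<open>det_on_image\<close> applies.\<close>

lemma det_submatrix_eq_det_on:
  assumes "A \<in> carrier_mat n n" "I \<subseteq> {..<n}"
  shows "det (submatrix A I I) = det_on I (\<lambda>i j. A $$ (i, j))"
proof -
  have fin: "finite I" using assms(2) finite_subset by blast
  have "{i. i < n \<and> i \<in> I} = I" using assms(2) by auto
  then have card: "card {i. i < dim_row A \<and> i \<in> I} = card I" "card {i. i < dim_col A \<and> i \<in> I} = card I"
    using assms(1) by auto
  have "bij_betw (pick I) {..<card I} I"
    unfolding bij_betw_def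
  proof
    show inj: "inj_on (pick I) {..<card I}"
      by (rule linorder_inj_onI) (use pick_mono_le[of _ I] in \<open>fastforce+\<close>)
    show "pick I ` {..<card I} = I"
      by (rule card_subset_eq[OF fin]) (auto simp: card_image[OF inj] pick_in_set_le)
  qed
  then have im: "pick I ` {..<card I} = I" and inj: "inj_on (pick I) {..<card I}"
    by (auto simp: bij_betw_def)
  have carr: "submatrix A I I \<in> carrier_mat (card I) (card I)"
    by (rule carrier_matI) (simp_all only: dim_submatrix card)
  have "det (submatrix A I I) = det_on {..<card I} (\<lambda>i j. submatrix A I I $$ (i, j))"
    by (rule det_eq_det_on[OF carr])
  also have "\<dots> = det_on {..<card I} (\<lambda>i j. A $$ (pick I i, pick I j))"
    by (rule det_on_cong) (simp add: submatrix_index card)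
  also have "\<dots> = det_on I (\<lambda>i j. A $$ (i, j))"
    using det_on_image[OF _ inj, of "\<lambda>i j. A $$ (i, j)"] im by simp
  finally show ?thesis .
qed

text \<open>Any enumeration of \<open>S\<close> turns the claim into the singularity criterion for
  ordinary matrices; the entry \<open>x k\<close> certifies that the kernel vector is
  nonzero.\<close>

lemma det_on_eq_0_if_kernel:
  fixes A :: "'b \<Rightarrow> 'b \<Rightarrow> 'r::idom"
  assumes "finite S" "\<And>i. i \<in> S \<Longrightarrow> (\<Sum>j\<in>S. A i j * x j) = 0" "k \<in> S" "x k \<noteq> 0"
  shows "det_on S A = 0"
proof -
  obtain h where h: "bij_betw h {..<card S} S"
    using ex_bij_betw_nat_finite[OF assms(1)] by (auto simp: atLeast0LessThan)
  define M where "M = mat (card S) (card S) (\<lambda>(i, j). A (h i) (h j))"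
  have M: "M \<in> carrier_mat (card S) (card S)" by (simp add: M_def)
  have im: "h ` {..<card S} = S" and inj: "inj_on h {..<card S}"
    using h by (auto simp: bij_betw_def)
  have "det_on S A = det_on {..<card S} (\<lambda>i j. A (h i) (h j))"
    using det_on_image[OF _ inj, of A] im by simp
  also have "\<dots> = det M"
    unfolding det_eq_det_on[OF M] by (rule det_on_cong) (simp add: M_def)
  also have "\<dots> = 0"
    unfolding det_0_iff_vec_prod_zero[OF M]
  proof (intro exI conjI)
    let ?v = "vec (card S) (\<lambda>j. x (h j))"
    show "?v \<in> carrier_vec (card S)" by simp
    obtain l where "l < card S" "h l = k" using im assms(3) by (metis imageE lessThan_iff)
    then show "?v \<noteq> 0\<^sub>v (card S)"
      using assms(4) by (metis index_vec index_zero_vec(1))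
    show "M *\<^sub>v ?v = 0\<^sub>v (card S)"
    proof (rule eq_vecI)
      fix i assume "i < dim_vec (0\<^sub>v (card S) :: 'r vec)"
      then have i: "i < card S" by simp
      have "(M *\<^sub>v ?v) $ i = (\<Sum>j<card S. A (h i) (h j) * x (h j))"
        using i by (simp add: M_def scalar_prod_def atLeast0LessThan)
      also have "\<dots> = (\<Sum>j\<in>S. A (h i) j * x j)"
        by (rule sum.reindex_bij_betw[OF h])
      also have "\<dots> = 0" using assms(2) im i by blast
      finally show "(M *\<^sub>v ?v) $ i = 0\<^sub>v (card S) $ i" using i by simp
    qed (simp add: M_def)
  qed
  finally show ?thesis .
qed

text \<open>Multiplying out, \<open>S\<close> collects the rows where the diagonal summand is
  chosen. Such a choice kills every permutation that moves a point of \<open>S\<close>, and the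
  survivors are the permutations of \<open>V - S\<close>.\<close>

lemma det_on_add_diag:
  fixes A :: "'b \<Rightarrow> 'b \<Rightarrow> 'r::comm_ring_1"
  assumes "finite V"
  shows "det_on V (\<lambda>i j. A i j + (if i = j then x i else 0))
       = (\<Sum>S\<in>Pow V. (\<Prod>i\<in>S. x i) * det_on (V - S) A)"
proof -
  have fp: "finite {p. p permutes V}" using assms by (rule finite_permutations)
  have "det_on V (\<lambda>i j. A i j + (if i = j then x i else 0))
     = (\<Sum>p | p permutes V. \<Sum>S\<in>Pow V. of_int (sign p) *
         ((\<Prod>i\<in>S. if i = p i then x i else 0) * (\<Prod>i\<in>V - S. A i (p i))))"
    unfolding det_on_def
    by (subst add.commute, subst prod_add[OF assms]) (simp add: sum_distrib_left)
  also have "\<dots> = (\<Sum>S\<in>Pow V. \<Sum>p | p permutes V. of_int (sign p) *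
         ((\<Prod>i\<in>S. if i = p i then x i else 0) * (\<Prod>i\<in>V - S. A i (p i))))"
    by (rule sum.swap)
  also have "\<dots> = (\<Sum>S\<in>Pow V. (\<Prod>i\<in>S. x i) * det_on (V - S) A)"
  proof (rule sum.cong[OF refl])
    fix S assume "S \<in> Pow V"
    then have S: "S \<subseteq> V" "finite S" using assms finite_subset by auto
    have "(\<Sum>p | p permutes V. of_int (sign p) *
         ((\<Prod>i\<in>S. if i = p i then x i else 0) * (\<Prod>i\<in>V - S. A i (p i))))
       = (\<Sum>p | p permutes V - S. of_int (sign p) *
         ((\<Prod>i\<in>S. x i) * (\<Prod>i\<in>V - S. A i (p i))))"
    proof (rule sum.mono_neutral_cong_right[OF fp])
      show "{p. p permutes V - S} \<subseteq> {p. p permutes V}"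
        by (auto intro: permutes_subset)
      show "\<forall>p\<in>{p. p permutes V} - {p. p permutes V - S}. of_int (sign p) *
         ((\<Prod>i\<in>S. if i = p i then x i else 0) * (\<Prod>i\<in>V - S. A i (p i))) = 0"
      proof
        fix p assume "p \<in> {p. p permutes V} - {p. p permutes V - S}"
        then have p: "p permutes V" "\<not> p permutes V - S" by auto
        then obtain i where "i \<in> S" "p i \<noteq> i"
          using permutes_superset[OF p(1), of "V - S"] S by blast
        then have "(\<Prod>i\<in>S. if i = p i then x i else 0) = 0"
          using S by (intro prod_zero) force+
        then show "of_int (sign p) *
         ((\<Prod>i\<in>S. if i = p i then x i else 0) * (\<Prod>i\<in>V - S. A i (p i))) = 0" by simp
      qed
      fix p assume "p \<in> {p. p permutes V - S}"
      then have "p i = i" if "i \<in> S" for i using that by (auto intro: permutes_not_in)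
      then have "(\<Prod>i\<in>S. if i = p i then x i else 0) = (\<Prod>i\<in>S. x i)"
        by (intro prod.cong) auto
      then show "of_int (sign p) *
         ((\<Prod>i\<in>S. if i = p i then x i else 0) * (\<Prod>i\<in>V - S. A i (p i)))
         = of_int (sign p) * ((\<Prod>i\<in>S. x i) * (\<Prod>i\<in>V - S. A i (p i)))" by simp
    qed
    also have "\<dots> = (\<Prod>i\<in>S. x i) * det_on (V - S) A"
      by (simp add: det_on_def sum_distrib_left mult_ac)
    finally show "(\<Sum>p | p permutes V. of_int (sign p) *
         ((\<Prod>i\<in>S. if i = p i then x i else 0) * (\<Prod>i\<in>V - S. A i (p i))))
       = (\<Prod>i\<in>S. x i) * det_on (V - S) A" .
  qed
  finally show ?thesis .
qed

lemma det_on_scale: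
  "det_on S (\<lambda>i j. c * A i j) = c ^ card S * det_on S A"
  by (simp add: det_on_def prod.distrib sum_distrib_left mult_ac)

text \<open>Multilinearity in the rows: \<open>f\<close> records which summand is chosen in each
  row.\<close>

lemma det_on_sum_rows:
  fixes A :: "'b \<Rightarrow> 'c \<Rightarrow> 'b \<Rightarrow> 'r::comm_ring_1"
  assumes "finite S" "finite K"
  shows "det_on S (\<lambda>i j. \<Sum>k\<in>K. c i k * A i k j)
       = (\<Sum>f\<in>S \<rightarrow>\<^sub>E K. (\<Prod>i\<in>S. c i (f i)) * det_on S (\<lambda>i j. A i (f i) j))"
proof -
  have "det_on S (\<lambda>i j. \<Sum>k\<in>K. c i k * A i k j)
      = (\<Sum>p | p permutes S. \<Sum>f\<in>S \<rightarrow>\<^sub>E K.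
           (\<Prod>i\<in>S. c i (f i)) * (of_int (sign p) * (\<Prod>i\<in>S. A i (f i) (p i))))"
    unfolding det_on_def
    by (simp add: prod_sum_PiE assms sum_distrib_left prod.distrib mult_ac)
  also have "\<dots> = (\<Sum>f\<in>S \<rightarrow>\<^sub>E K. (\<Prod>i\<in>S. c i (f i)) * det_on S (\<lambda>i j. A i (f i) j))"
    by (subst sum.swap) (simp add: det_on_def sum_distrib_left)
  finally show ?thesis .
qed

section \<open>The weighted matrix-tree theorem\<close>

text \<open>Parent functions are defined on \<open>V - {r}\<close> only; the value at \<open>r\<close> is irrelevant here,
  since only the first visit to \<open>r\<close> matters.\<close>

definition rooted :: "'a set \<Rightarrow> 'a \<Rightarrow> ('a \<Rightarrow> 'a) \<Rightarrow> bool" where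
  "rooted V r f \<longleftrightarrow> (\<forall>x\<in>V. \<exists>k. (f ^^ k) x = r)"

text \<open>The orbit of a point of \<open>B\<close> would stay in \<open>B\<close> and miss
  \<open>r\<close>. Most later facts about rooted functions are obtained by exhibiting a suitable
  invariant set.\<close>

lemma rooted_no_invariant_set:
  assumes "rooted V r f" "B \<subseteq> V - {r}" "f ` B \<subseteq> B"
  shows "B = {}"
proof (rule ccontr)
  assume "B \<noteq> {}"
  then obtain x where x: "x \<in> B" by auto
  have "(f ^^ k) x \<in> B" for k using x assms(3) by (induction k) auto
  then show False using x assms(1,2) unfolding rooted_def by blast
qed

lemma rooted_no_fixpoint:
  assumes "rooted V r f" "x \<in> V - {r}"
  shows "f x \<noteq> x"
  using rooted_no_invariant_set[OF assms(1), of "{x}"] assms(2) by auto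

lemma rooted_no_two_cycle:
  assumes "rooted V r f" "x \<in> V - {r}" "y \<in> V - {r}" "f x = y" "f y = x"
  shows False
  using rooted_no_invariant_set[OF assms(1), of "{x, y}"] assms(2-) by auto

text \<open>The height is the number of steps to the first visit of \<open>r\<close>; moving to the
  parent saves one step.\<close>

lemma rooted_height:
  assumes "rooted V r f"
  obtains h :: "'a \<Rightarrow> nat" where "\<And>x. x \<in> V - {r} \<Longrightarrow> h (f x) < h x"
proof
  define h where "h x = (LEAST k. (f ^^ k) x = r)" for x
  fix x assume x: "x \<in> V - {r}"
  then have "\<exists>k. (f ^^ k) x = r" using assms by (auto simp: rooted_def)
  then have hx: "(f ^^ h x) x = r" unfolding h_def by (rule LeastI_ex)
  then obtain m where m: "h x = Suc m" using x by (cases "h x") auto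
  have "(f ^^ m) (f x) = r" using hx m by (simp add: funpow_swap1)
  then have "h (f x) \<le> m" unfolding h_def by (rule Least_le)
  then show "h (f x) < h x" using m by simp
qed

text \<open>A permutation contributes only if it sends every point it moves to its parent. The moved
  points then form an \<open>f\<close>-invariant set avoiding \<open>r\<close>, which is empty, so
  only the identity remains.\<close>

lemma det_on_rooted:
  assumes "finite V" "rooted V r f"
  shows "det_on (V - {r}) (\<lambda>i j. of_bool (i = j) - of_bool (f i = j)) = (1 :: 'r::comm_ring_1)"
proof -
  let ?S = "V - {r}"
  let ?t = "\<lambda>p. of_int (sign p) * (\<Prod>i\<in>?S. of_bool (i = p i) - of_bool (f i = p i)) :: 'r"
  have "det_on ?S (\<lambda>i j. of_bool (i = j) - of_bool (f i = j)) = (\<Sum>p | p permutes ?S. ?t p)"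
    by (simp add: det_on_def)
  also have "\<dots> = (\<Sum>p\<in>{id}. ?t p)"
  proof (rule sum.mono_neutral_right)
    show "finite {p. p permutes ?S}" using assms(1) by (intro finite_permutations) simp
    show "{id} \<subseteq> {p. p permutes ?S}" by (simp add: permutes_id)
    show "\<forall>p\<in>{p. p permutes ?S} - {id}. ?t p = 0"
    proof
      fix p assume "p \<in> {p. p permutes ?S} - {id}"
      then have p: "p permutes ?S" "p \<noteq> id" by auto
      have "\<exists>i\<in>?S. p i \<noteq> i \<and> p i \<noteq> f i"
      proof (rule ccontr)
        assume *: "\<not> ?thesis"
        let ?B = "{i \<in> ?S. p i \<noteq> i}"
        have "f ` ?B \<subseteq> ?B"
        proof
          fix y assume "y \<in> f ` ?B"
          then obtain i where i: "i \<in> ?S" "p i \<noteq> i" "y = f i" by auto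
          then have y: "y = p i" using * by auto
          then have "p y \<noteq> y" using i(2) permutes_inj[OF p(1)] by (metis injD)
          moreover have "y \<in> ?S" unfolding y using permutes_in_image[OF p(1)] i(1) by blast
          ultimately show "y \<in> ?B" by simp
        qed
        then have "?B = {}" by (intro rooted_no_invariant_set[OF assms(2)]) auto
        then have "p i = i" for i using permutes_not_in[OF p(1), of i] by blast
        then show False using p(2) by (auto simp: fun_eq_iff)
      qed
      then obtain i where i: "i \<in> ?S" "i \<noteq> p i" "f i \<noteq> p i" by metis
      then have "(\<Prod>i\<in>?S. of_bool (i = p i) - of_bool (f i = p i)) = (0 :: 'r)"
        using assms(1) by (intro prod_zero bexI[of _ i]) auto
      then show "?t p = 0" by simp
    qed
  qed
  \<comment> \<open>For the identity the factors are \<open>1 - of_bool (f i = i)\<close>, and there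
    are no fixed points off the root.\<close>
  also have "\<dots> = 1"
    using rooted_no_fixpoint[OF assms(2)] by (auto intro!: prod.neutral)
  finally show ?thesis .
qed

text \<open>The indicator of the set of vertices that never reach the root lies in the kernel.\<close>

lemma det_on_not_rooted:
  assumes "finite V" "f \<in> V - {r} \<rightarrow> V" "\<not> rooted V r f"
  shows "det_on (V - {r}) (\<lambda>i j. of_bool (i = j) - of_bool (f i = j)) = (0 :: 'r::idom)"
proof -
  define C where "C = {x \<in> V. \<forall>k. (f ^^ k) x \<noteq> r}"
  have rC: "r \<notin> C" by (auto simp: C_def intro!: exI[of _ 0])
  \<comment> \<open>Membership in \<open>C\<close> is constant along \<open>f\<close>, so the two
    nonzero entries of a row cancel against the indicator of \<open>C\<close>.\<close>
  have step: "f x \<in> C \<longleftrightarrow> x \<in> C" if x: "x \<in> V - {r}" for x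
  proof
    assume fx: "f x \<in> C"
    have "(f ^^ k) x \<noteq> r" for k
    proof (cases k)
      case 0 then show ?thesis using x by simp
    next
      case (Suc m)
      then show ?thesis using fx by (simp add: C_def funpow_swap1)
    qed
    then show "x \<in> C" using x by (simp add: C_def)
  next
    assume xC: "x \<in> C"
    have "(f ^^ k) (f x) \<noteq> r" for k
    proof -
      have "(f ^^ Suc k) x \<noteq> r" using xC unfolding C_def by blast
      then show ?thesis by (simp add: funpow_swap1)
    qed
    then show "f x \<in> C" using x assms(2) by (auto simp: C_def)
  qed
  obtain k where k: "k \<in> C" using assms(3) by (auto simp: rooted_def C_def)
  show ?thesis
  proof (rule det_on_eq_0_if_kernel[where x = "\<lambda>j. of_bool (j \<in> C)" and k = k])
    show "k \<in> V - {r}" using k rC by (auto simp: C_def)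
    fix i assume i: "i \<in> V - {r}"
    have "(\<Sum>j\<in>V - {r}. (of_bool (i = j) - of_bool (f i = j)) * of_bool (j \<in> C) :: 'r)
       = (\<Sum>j\<in>V - {r}. (if i = j then of_bool (i \<in> C) else 0))
       - (\<Sum>j\<in>V - {r}. if f i = j then of_bool (f i \<in> C) else 0)"
      by (subst sum_subtractf[symmetric], rule sum.cong) auto
    \<comment> \<open>If \<open>f i = r\<close>, the second sum has no matching column, which agrees
      with \<open>r \<notin> C\<close>.\<close>
    also have "\<dots> = of_bool (i \<in> C) - of_bool (f i \<in> C)"
      using i assms(1,2) rC by (auto simp: Pi_iff)
    also have "\<dots> = 0" using step[OF i] by simp
    finally show "(\<Sum>j\<in>V - {r}. (of_bool (i = j) - of_bool (f i = j)) * of_bool (j \<in> C)) = (0::'r)" .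
  qed (use assms k in auto)
qed

section \<open>Rooted parent functions as spanning trees\<close>

definition parent_edges :: "'a set \<Rightarrow> ('a \<Rightarrow> 'a) \<Rightarrow> 'a set set" where
  "parent_edges S f = (\<lambda>x. {x, f x}) ` S"

text \<open>Two vertices with the same parent edge would be parents of each other, a two-cycle that
  never reaches the root.\<close>

lemma parent_edge_inj:
  assumes "rooted V r f"
  shows "inj_on (\<lambda>x. {x, f x}) (V - {r})"
  by (rule inj_onI) (metis assms doubleton_eq_iff rooted_no_two_cycle)

lemma parent_edges_doubleton:
  assumes "{x, y} \<in> parent_edges S f"
  shows "x \<in> S \<and> f x = y \<or> y \<in> S \<and> f y = x"
  using assms by (auto simp: parent_edges_def doubleton_eq_iff)

lemma sym_arcs_rtrancl_sym:
  assumes "(x, y) \<in> (sym_arcs E)\<^sup>*"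
  shows "(y, x) \<in> (sym_arcs E)\<^sup>*"
proof -
  have "sym (sym_arcs E)" by (auto simp: sym_def sym_arcs_def insert_commute)
  then show ?thesis using assms by (meson symD sym_rtrancl)
qed

text \<open>Each orbit is a walk to the root, and walks can be reversed, so any two vertices are
  joined through \<open>r\<close>.\<close>

lemma connected_parent_edges:
  assumes "r \<in> V" "f \<in> V - {r} \<rightarrow> V" "rooted V r f"
  shows "connected_graph V (parent_edges (V - {r}) f)"
proof -
  let ?R = "sym_arcs (parent_edges (V - {r}) f)"
  have to_root: "(x, r) \<in> ?R\<^sup>*" if "x \<in> V" "(f ^^ k) x = r" for k x
    using that
  proof (induction k arbitrary: x)
    case (Suc k)
    show ?case
    proof (cases "x = r")
      case False
      then have "(x, f x) \<in> ?R" using Suc.prems by (auto simp: sym_arcs_def parent_edges_def)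
      moreover have "(f x, r) \<in> ?R\<^sup>*"
        using Suc assms(2) False by (intro Suc.IH) (auto simp: funpow_swap1)
      ultimately show ?thesis by (rule converse_rtrancl_into_rtrancl)
    qed simp
  qed simp
  have "(x, r) \<in> ?R\<^sup>*" if "x \<in> V" for x
    using that assms(3) to_root by (auto simp: rooted_def)
  then have "(x, y) \<in> ?R\<^sup>*" if "x \<in> V" "y \<in> V" for x y
    using that by (meson rtrancl_trans sym_arcs_rtrancl_sym)
  then show ?thesis using assms(1) by (auto simp: connected_graph_def)
qed

text \<open>On a cycle, a vertex of maximal height could only be adjacent to its parent.\<close>

lemma acyclic_parent_edges:
  assumes "rooted V r f"
  shows "\<not> graph_cycle (parent_edges (V - {r}) f) xs"
proof
  assume cyc: "graph_cycle (parent_edges (V - {r}) f) xs"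
  let ?n = "length xs"
  have n: "3 \<le> ?n" and dist: "distinct xs"
    and edge: "\<And>i. i < ?n \<Longrightarrow> {xs ! i, xs ! (Suc i mod ?n)} \<in> parent_edges (V - {r}) f"
    using cyc by (auto simp: graph_cycle_def)
  obtain h :: "'a \<Rightarrow> nat" where h: "\<And>x. x \<in> V - {r} \<Longrightarrow> h (f x) < h x"
    using rooted_height[OF assms] by blast
  have ne: "(\<lambda>i. h (xs ! i)) ` {..<?n} \<noteq> {}" using n by (auto simp: lessThan_empty_iff)
  then have "Max ((\<lambda>i. h (xs ! i)) ` {..<?n}) \<in> (\<lambda>i. h (xs ! i)) ` {..<?n}"
    by (intro Max_in) auto
  then obtain i where i: "i < ?n" "h (xs ! i) = Max ((\<lambda>i. h (xs ! i)) ` {..<?n})" by auto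
  have max: "h (xs ! j) \<le> h (xs ! i)" if "j < ?n" for j
    unfolding i(2) using that by (intro Max_ge) auto
  \<comment> \<open>The opposite orientation, with \<open>xs ! i\<close> as parent of
    \<open>xs ! j\<close>, would make \<open>xs ! j\<close> higher than the maximum.\<close>
  have up: "f (xs ! i) = xs ! j"
    if "{xs ! i, xs ! j} \<in> parent_edges (V - {r}) f" "j < ?n" for j
    using parent_edges_doubleton[OF that(1)] h max[OF that(2)] by fastforce
  \<comment> \<open>\<open>a\<close> and \<open>b\<close> are the cyclic successor and predecessor
    of \<open>i\<close>. Both carry the parent of \<open>xs ! i\<close>, yet they differ because the
    cycle has length at least 3.\<close>
  define a where "a = Suc i mod ?n"
  define b where "b = (if i = 0 then ?n - 1 else i - 1)"
  have an: "a < ?n" unfolding a_def using n by (intro mod_less_divisor) linarith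
  have a: "f (xs ! i) = xs ! a"
    using up[OF _ an] edge[OF i(1)] by (simp add: a_def)
  have bn: "b < ?n" using n i(1) by (auto simp: b_def)
  have "Suc b mod ?n = i" using n i(1) by (auto simp: b_def)
  then have b: "f (xs ! i) = xs ! b"
    using edge[OF bn] up[OF _ bn] by (simp add: insert_commute)
  have "a = b" using a an b bn dist by (metis nth_eq_iff_index_eq)
  moreover have "a \<noteq> b"
  proof (cases "Suc i = ?n")
    case True then show ?thesis using n by (auto simp: a_def b_def)
  next
    case False
    then have "a = Suc i" using i(1) by (simp add: a_def)
    then show ?thesis using n i(1) by (auto simp: b_def)
  qed
  ultimately show False by simp
qed

lemma is_tree_parent_edges:
  assumes "finite V" "r \<in> V" "f \<in> V - {r} \<rightarrow> V" "rooted V r f"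
  shows "is_tree V (parent_edges (V - {r}) f)"
proof -
  have "simple_graph V (parent_edges (V - {r}) f)"
    unfolding simple_graph_def
  proof (intro conjI ballI assms(1))
    fix e assume "e \<in> parent_edges (V - {r}) f"
    then obtain x where x: "x \<in> V - {r}" "e = {x, f x}" by (auto simp: parent_edges_def)
    moreover have "f x \<noteq> x" by (rule rooted_no_fixpoint[OF assms(4) x(1)])
    ultimately show "\<exists>x\<in>V. \<exists>y\<in>V. x \<noteq> y \<and> e = {x, y}"
      using assms(3) by (metis DiffD1 PiE)
  qed
  then show ?thesis
    using connected_parent_edges[OF assms(2-)] acyclic_parent_edges[OF assms(4)]
    by (auto simp: is_tree_def)
qed

text \<open>If \<open>f\<close> and \<open>g\<close> disagree at \<open>x\<close>, the edge from
  \<open>x\<close> to \<open>y = g x\<close> must come from \<open>f y = x\<close>. Since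
  \<open>g y = x\<close> would be a two-cycle of \<open>g\<close>, they disagree at \<open>y\<close>
  too. So the set of disagreement is \<open>g\<close>-invariant, hence empty.\<close>

lemma parent_edges_eq_imp_eq:
  assumes "rooted V r f" "rooted V r g" "parent_edges (V - {r}) f = parent_edges (V - {r}) g"
    and "f \<in> V - {r} \<rightarrow>\<^sub>E V" "g \<in> V - {r} \<rightarrow>\<^sub>E V"
  shows "f = g"
proof -
  let ?B = "{x \<in> V - {r}. f x \<noteq> g x}"
  have "g ` ?B \<subseteq> ?B"
  proof
    fix y assume "y \<in> g ` ?B"
    then obtain x where x: "x \<in> V - {r}" "f x \<noteq> g x" "y = g x" by auto
    have "{x, y} \<in> parent_edges (V - {r}) f"
      unfolding assms(3) using x by (auto simp: parent_edges_def)
    then have y: "y \<in> V - {r}" "f y = x" using parent_edges_doubleton x by metis+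
    then have "g y \<noteq> x" using rooted_no_two_cycle[OF assms(2)] x by metis
    then show "y \<in> ?B" using y by auto
  qed
  then have "?B = {}" by (intro rooted_no_invariant_set[OF assms(2)]) auto
  then show ?thesis using assms(4,5) by (intro PiE_ext) auto
qed

text \<open>Vertices are prepended one at a time; if the new one already lies on the path, the path
  is cut back to the suffix starting there.\<close>

lemma rtrancl_imp_distinct_path:
  assumes "(x, y) \<in> R\<^sup>*"
  shows "\<exists>xs. xs \<noteq> [] \<and> hd xs = x \<and> last xs = y \<and> distinct xs \<and> successively (\<lambda>a b. (a, b) \<in> R) xs"
  using assms
proof (induction rule: converse_rtrancl_induct)
  case base
  show ?case by (intro exI[of _ "[y]"]) auto
next
  case (step x z)
  then obtain xs where xs: "xs \<noteq> []" "hd xs = z" "last xs = y" "distinct xs"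
    "successively (\<lambda>a b. (a, b) \<in> R) xs" by auto
  show ?case
  proof (cases "x \<in> set xs")
    case True
    then obtain ys zs where "xs = ys @ x # zs" by (auto simp: in_set_conv_decomp)
    then show ?thesis using xs by (intro exI[of _ "x # zs"]) (auto simp: successively_append_iff)
  next
    case False
    then show ?thesis using xs step(1)
      by (intro exI[of _ "x # xs"]) (auto simp: successively_Cons)
  qed
qed

text \<open>An edge of \<open>T\<close> outside \<open>T'\<close> would close a simple path of
  \<open>T'\<close> into a cycle of \<open>T\<close>. This replaces counting edges when a parent
  function is shown to use the whole tree.\<close>

lemma connected_acyclic_minimal:
  assumes "is_tree V T" "T' \<subseteq> T" "connected_graph V T'"
  shows "T' = T"
proof (rule ccontr)
  assume "T' \<noteq> T"
  then obtain e where e: "e \<in> T" "e \<notin> T'" using assms(2) by auto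
  then obtain x y where xy: "x \<in> V" "y \<in> V" "x \<noteq> y" "e = {x, y}"
    using assms(1) by (auto simp: is_tree_def simple_graph_def)
  then have "(x, y) \<in> (sym_arcs T')\<^sup>*" using assms(3) by (auto simp: connected_graph_def)
  then obtain xs where xs: "xs \<noteq> []" "hd xs = x" "last xs = y" "distinct xs"
    and succ: "successively (\<lambda>a b. (a, b) \<in> sym_arcs T') xs"
    using rtrancl_imp_distinct_path by metis
  have edge: "{xs ! i, xs ! Suc i} \<in> T'" if "Suc i < length xs" for i
    using succ that by (auto simp: successively_conv_nth sym_arcs_def)
  have hd: "xs ! 0 = x" and last: "xs ! (length xs - 1) = y"
    using xs by (auto simp: hd_conv_nth last_conv_nth)
  \<comment> \<open>Length 1 would force \<open>x = y\<close>, and length 2 would put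
    \<open>e\<close> itself into \<open>T'\<close>.\<close>
  have "length xs \<noteq> 0" "length xs \<noteq> 1" "length xs \<noteq> 2"
    using xs hd last xy e edge[of 0] by auto
  then have len: "3 \<le> length xs" by linarith
  have "graph_cycle T xs"
    unfolding graph_cycle_def
  proof (intro conjI allI impI len xs(4))
    fix i assume i: "i < length xs"
    show "{xs ! i, xs ! (Suc i mod length xs)} \<in> T"
    proof (cases "Suc i < length xs")
      case True
      then show ?thesis using edge assms(2) by auto
    next
      case False
      then have "Suc i = length xs" using i by simp
      then have "Suc i mod length xs = 0" "i = length xs - 1" by auto
      then show ?thesis using hd last e xy by (simp add: insert_commute)
    qed
  qed
  then show False using assms(1) by (auto simp: is_tree_def)
qed

text \<open>The parent of a vertex is a neighbour that is strictly closer to the root.\<close>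

lemma tree_parent_function:
  assumes "is_tree V T" "r \<in> V"
  obtains f where "f \<in> V - {r} \<rightarrow>\<^sub>E V" "rooted V r f" "parent_edges (V - {r}) f = T"
proof -
  let ?R = "sym_arcs T"
  define d where "d x = (LEAST k. (x, r) \<in> ?R ^^ k)" for x
  have RV: "y \<in> V" if "(x, y) \<in> ?R" for x y
    using that assms(1) by (auto simp: is_tree_def simple_graph_def sym_arcs_def doubleton_eq_iff)
  have d: "(x, r) \<in> ?R ^^ d x" if "x \<in> V" for x
  proof -
    have "(x, r) \<in> ?R\<^sup>*" using that assms by (auto simp: is_tree_def connected_graph_def)
    then have "\<exists>k. (x, r) \<in> ?R ^^ k" by (simp add: rtrancl_is_UN_relpow)
    then show ?thesis unfolding d_def by (rule LeastI_ex)
  qed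
  have ex: "\<exists>y. (x, y) \<in> ?R \<and> d y < d x" if x: "x \<in> V - {r}" for x
  proof -
    have dx: "(x, r) \<in> ?R ^^ d x" using d x by blast
    then obtain m where m: "d x = Suc m" using x by (cases "d x") auto
    then obtain y where y: "(x, y) \<in> ?R" "(y, r) \<in> ?R ^^ m"
      using dx by (metis relpow_Suc_D2)
    then have "d y \<le> m" unfolding d_def by (intro Least_le)
    then show ?thesis using y m by auto
  qed
  \<comment> \<open>The restriction makes \<open>f\<close> extensional, so that trees correspond to
    elements of a \<open>PiE\<close> set uniquely.\<close>
  define f where "f = restrict (\<lambda>x. SOME y. (x, y) \<in> ?R \<and> d y < d x) (V - {r})"
  have f: "(x, f x) \<in> ?R" "d (f x) < d x" if "x \<in> V - {r}" for x
    using someI_ex[OF ex[OF that]] that by (auto simp: f_def)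
  have fV: "f \<in> V - {r} \<rightarrow>\<^sub>E V" using f RV by (auto simp: f_def)
  have "\<exists>k. (f ^^ k) x = r" if "x \<in> V" for x
    using that
  proof (induction "d x" arbitrary: x rule: less_induct)
    case less
    show ?case
    proof (cases "x = r")
      case True then show ?thesis by (intro exI[of _ 0]) simp
    next
      case False
      then have "\<exists>k. (f ^^ k) (f x) = r"
        using less.prems f[of x] RV by (intro less.hyps) auto
      then obtain k where "(f ^^ k) (f x) = r" by blast
      then show ?thesis by (intro exI[of _ "Suc k"]) (simp add: funpow_swap1)
    qed
  qed
  then have rooted: "rooted V r f" by (simp add: rooted_def)
  have "parent_edges (V - {r}) f = T"
  proof (rule connected_acyclic_minimal[OF assms(1)])
    show "parent_edges (V - {r}) f \<subseteq> T"
      using f(1) by (auto simp: parent_edges_def sym_arcs_def)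
    show "connected_graph V (parent_edges (V - {r}) f)"
      using assms(2) fV rooted by (intro connected_parent_edges) auto
  qed
  with fV rooted that show thesis by blast
qed

text \<open>Every spanning tree can be oriented towards \<open>r\<close> in exactly one way; this
  turns the sum over parent functions into the sum over trees.\<close>

lemma bij_betw_parent_edges_spanning_trees:
  assumes "finite V" "r \<in> V"
  shows "bij_betw (parent_edges (V - {r}))
           {f \<in> V - {r} \<rightarrow>\<^sub>E V. rooted V r f \<and> parent_edges (V - {r}) f \<subseteq> E} (spanning_trees V E)"
  unfolding bij_betw_def
proof
  show "inj_on (parent_edges (V - {r}))
      {f \<in> V - {r} \<rightarrow>\<^sub>E V. rooted V r f \<and> parent_edges (V - {r}) f \<subseteq> E}"
    by (rule inj_onI, rule parent_edges_eq_imp_eq[of V r]) simp_all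
  show "parent_edges (V - {r}) ` {f \<in> V - {r} \<rightarrow>\<^sub>E V. rooted V r f \<and> parent_edges (V - {r}) f \<subseteq> E}
      = spanning_trees V E"
  proof (intro equalityI subsetI)
    fix T assume "T \<in> spanning_trees V E"
    then show "T \<in> parent_edges (V - {r}) ` {f \<in> V - {r} \<rightarrow>\<^sub>E V. rooted V r f \<and> parent_edges (V - {r}) f \<subseteq> E}"
      using tree_parent_function[OF _ assms(2), of T] by (auto simp: spanning_trees_def)
  qed (use is_tree_parent_edges[OF assms] in \<open>auto simp: spanning_trees_def\<close>)
qed

section \<open>The Laplacian, its minors and the degree sum\<close>

definition arc_weight :: "'a set set \<Rightarrow> ('a \<times> 'a \<Rightarrow> complex) \<Rightarrow> 'a \<Rightarrow> 'a \<Rightarrow> complex" where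
  "arc_weight E w x y = (if {x, y} \<in> E then w (x, y) else 0)"

text \<open>The vertex-indexed counterpart of \<open>weighted_laplacian\<close>, in the form that
  \<open>det_on\<close> takes.\<close>

definition laplacian_fun :: "'a set set \<Rightarrow> ('a \<times> 'a \<Rightarrow> complex) \<Rightarrow> 'a \<Rightarrow> 'a \<Rightarrow> complex" where
  "laplacian_fun E w x y = (if x = y then weighted_degree E w x else 0) - arc_weight E w x y"

text \<open>The choice operator may return either arc of the edge; symmetry of \<open>w\<close>
  makes the outcome the same.\<close>

lemma edge_weight_doubleton:
  assumes "symmetric_weight E w" "{x, y} \<in> E"
  shows "edge_weight w {x, y} = w (x, y)"
proof -
  define a where "a = (SOME a. {fst a, snd a} = {x, y})"
  have "{fst a, snd a} = {x, y}" unfolding a_def by (rule someI[of _ "(x, y)"]) simp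
  then have "a = (x, y) \<or> a = (y, x)" by (cases a) (auto simp: doubleton_eq_iff)
  then have "w a = w (x, y)"
    using assms by (auto simp: symmetric_weight_def sym_arcs_def)
  then show ?thesis by (simp add: edge_weight_def a_def)
qed

lemma weighted_degree_eq_sum:
  assumes "simple_graph V E"
  shows "weighted_degree E w x = (\<Sum>y\<in>V. arc_weight E w x y)"
proof -
  have fin: "finite V" using assms by (simp add: simple_graph_def)
  have "(\<Sum>y\<in>V. arc_weight E w x y) = (\<Sum>y\<in>{y \<in> V. {x, y} \<in> E}. w (x, y))"
    using fin by (simp add: arc_weight_def sum.inter_filter)
  also have "\<dots> = weighted_degree E w x"
    unfolding weighted_degree_def
  proof (rule sum.reindex_bij_witness[where i = snd and j = "\<lambda>y. (x, y)"])
    fix a assume "a \<in> {a \<in> sym_arcs E. fst a = x}"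
    then have "{x, snd a} \<in> E" by (auto simp: sym_arcs_def)
    moreover from this obtain u v where "u \<in> V" "v \<in> V" "{x, snd a} = {u, v}"
      using assms by (auto simp: simple_graph_def)
    ultimately show "snd a \<in> {y \<in> V. {x, y} \<in> E}" by (auto simp: doubleton_eq_iff insert_commute)
  qed (auto simp: sym_arcs_def)
  finally show ?thesis by simp
qed

lemma laplacian_row_sum:
  assumes "simple_graph V E" "x \<in> V"
  shows "(\<Sum>y\<in>V. laplacian_fun E w x y) = 0"
  using assms
  by (simp add: laplacian_fun_def sum_subtractf weighted_degree_eq_sum simple_graph_def)

text \<open>The rows sum to 0, so the all-ones vector lies in the kernel.\<close>

lemma det_on_laplacian_eq_0:
  assumes "simple_graph V E" "V \<noteq> {}"
  shows "det_on V (laplacian_fun E w) = 0"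
proof -
  obtain k where "k \<in> V" using assms(2) by auto
  then show ?thesis
    using assms(1) laplacian_row_sum[OF assms(1)]
    by (intro det_on_eq_0_if_kernel[where x = "\<lambda>_. 1" and k = k]) (auto simp: simple_graph_def)
qed

lemma weighted_matrix_tree:
  assumes "simple_graph V E" "symmetric_weight E w" "r \<in> V"
  shows "det_on (V - {r}) (laplacian_fun E w) = weighted_complexity V E w"
proof -
  let ?S = "V - {r}"
  let ?c = "arc_weight E w"
  let ?F = "{f \<in> ?S \<rightarrow>\<^sub>E V. rooted V r f \<and> parent_edges ?S f \<subseteq> E}"
  have fin: "finite V" using assms(1) by (simp add: simple_graph_def)
  have "det_on ?S (laplacian_fun E w)
      = det_on ?S (\<lambda>i j. \<Sum>k\<in>V. ?c i k * (of_bool (i = j) - of_bool (k = j)))"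
  proof (rule det_on_cong)
    fix i j assume ij: "i \<in> ?S" "j \<in> ?S"
    \<comment> \<open>The first part sums to the degree on the diagonal, the second leaves only
      \<open>k = j\<close>. The summand \<open>k = r\<close> feeds the degree alone, as the column
      of \<open>r\<close> is deleted.\<close>
    have "(\<Sum>k\<in>V. ?c i k * (of_bool (i = j) - of_bool (k = j)))
        = (\<Sum>k\<in>V. if i = j then ?c i k else 0) - (\<Sum>k\<in>V. if k = j then ?c i j else 0)"
      by (subst sum_subtractf[symmetric], rule sum.cong) auto
    also have "\<dots> = laplacian_fun E w i j"
      using ij fin by (auto simp: laplacian_fun_def weighted_degree_eq_sum[OF assms(1)])
    finally show "laplacian_fun E w i j
      = (\<Sum>k\<in>V. ?c i k * (of_bool (i = j) - of_bool (k = j)))" by simp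
  qed
  also have "\<dots> = (\<Sum>f\<in>?S \<rightarrow>\<^sub>E V. (\<Prod>i\<in>?S. ?c i (f i))
      * det_on ?S (\<lambda>i j. of_bool (i = j) - of_bool (f i = j)))"
    using fin by (intro det_on_sum_rows) auto
  also have "\<dots> = (\<Sum>f\<in>?F. \<Prod>e\<in>parent_edges ?S f. edge_weight w e)"
  proof (rule sum.mono_neutral_cong_right)
    show "finite (?S \<rightarrow>\<^sub>E V)" using fin by (intro finite_PiE) auto
    show "\<forall>f\<in>(?S \<rightarrow>\<^sub>E V) - ?F. (\<Prod>i\<in>?S. ?c i (f i))
        * det_on ?S (\<lambda>i j. of_bool (i = j) - of_bool (f i = j)) = 0"
    proof
      fix f assume f: "f \<in> (?S \<rightarrow>\<^sub>E V) - ?F"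
      show "(\<Prod>i\<in>?S. ?c i (f i))
        * det_on ?S (\<lambda>i j. of_bool (i = j) - of_bool (f i = j)) = 0"
      \<comment> \<open>A rooted \<open>f\<close> outside \<open>?F\<close> uses a non-edge, so its
        weight vanishes; otherwise the determinant does.\<close>
      proof (cases "rooted V r f")
        case True
        then obtain i where "i \<in> ?S" "{i, f i} \<notin> E" using f by (auto simp: parent_edges_def)
        then have "(\<Prod>i\<in>?S. ?c i (f i)) = 0"
          using fin by (intro prod_zero bexI[of _ i]) (auto simp: arc_weight_def)
        then show ?thesis by simp
      next
        case False
        then have "det_on ?S (\<lambda>i j. of_bool (i = j) - of_bool (f i = j)) = (0 :: complex)"
          using f fin by (intro det_on_not_rooted) auto
        then show ?thesis by simp
      qed
    qed
    fix f assume "f \<in> ?F"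
    then have f: "rooted V r f" "parent_edges ?S f \<subseteq> E" by auto
    have "(\<Prod>i\<in>?S. ?c i (f i)) = (\<Prod>i\<in>?S. edge_weight w {i, f i})"
      using f(2) edge_weight_doubleton[OF assms(2)]
      by (intro prod.cong) (auto simp: arc_weight_def parent_edges_def)
    also have "\<dots> = (\<Prod>e\<in>parent_edges ?S f. edge_weight w e)"
      unfolding parent_edges_def by (simp add: prod.reindex[OF parent_edge_inj[OF f(1)]])
    finally show "(\<Prod>i\<in>?S. ?c i (f i)) * det_on ?S (\<lambda>i j. of_bool (i = j) - of_bool (f i = j))
       = (\<Prod>e\<in>parent_edges ?S f. edge_weight w e)"
      using det_on_rooted[OF fin f(1), where ?'r = complex] by simp
  qed auto
  also have "\<dots> = weighted_complexity V E w"
    unfolding weighted_complexity_def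
    by (rule sum.reindex_bij_betw[OF bij_betw_parent_edges_spanning_trees[OF fin assms(3)]])
  finally show ?thesis .
qed

text \<open>Weighted handshake: grouping arcs by their edge, each edge has exactly two arcs since
  its ends are distinct.\<close>

lemma sum_weighted_degree:
  assumes "simple_graph V E" "symmetric_weight E w"
  shows "(\<Sum>x\<in>V. weighted_degree E w x) = 2 * total_weight E w"
proof -
  have fin: "finite V" using assms(1) by (simp add: simple_graph_def)
  have "E \<subseteq> Pow V" using assms(1) by (auto simp: simple_graph_def)
  then have finE: "finite E" using fin by (simp add: finite_subset)
  have "(\<Sum>x\<in>V. weighted_degree E w x) = (\<Sum>a\<in>V \<times> V. arc_weight E w (fst a) (snd a))"
    by (simp add: weighted_degree_eq_sum[OF assms(1)] sum.cartesian_product case_prod_unfold)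
  also have "\<dots> = (\<Sum>a\<in>{a \<in> V \<times> V. {fst a, snd a} \<in> E}. edge_weight w {fst a, snd a})"
    using fin edge_weight_doubleton[OF assms(2)]
    by (intro sum.mono_neutral_cong_right) (auto simp: arc_weight_def)
  also have "\<dots> = (\<Sum>e\<in>E. \<Sum>a\<in>{a \<in> {a \<in> V \<times> V. {fst a, snd a} \<in> E}. {fst a, snd a} = e}.
      edge_weight w {fst a, snd a})"
    using fin finE by (intro sum.group[symmetric]) auto
  also have "\<dots> = (\<Sum>e\<in>E. 2 * edge_weight w e)"
  proof (rule sum.cong[OF refl])
    fix e assume e: "e \<in> E"
    then obtain x y where xy: "x \<in> V" "y \<in> V" "x \<noteq> y" "e = {x, y}"
      using assms(1) by (auto simp: simple_graph_def)
    have "{a \<in> {a \<in> V \<times> V. {fst a, snd a} \<in> E}. {fst a, snd a} = e} = {(x, y), (y, x)}"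
    proof (intro equalityI subsetI)
      fix a assume "a \<in> {a \<in> {a \<in> V \<times> V. {fst a, snd a} \<in> E}. {fst a, snd a} = e}"
      then have "{fst a, snd a} = {x, y}" using xy by simp
      then show "a \<in> {(x, y), (y, x)}" by (cases a) (auto simp: doubleton_eq_iff)
    qed (use xy e in \<open>auto simp: insert_commute\<close>)
    then show "(\<Sum>a\<in>{a \<in> {a \<in> V \<times> V. {fst a, snd a} \<in> E}. {fst a, snd a} = e}.
      edge_weight w {fst a, snd a}) = 2 * edge_weight w e"
      using xy by (simp add: insert_commute)
  qed
  finally show ?thesis by (simp add: total_weight_def sum_distrib_left)
qed

section \<open>Expansion of the determinant and its second derivatives\<close>

text \<open>The two-variable chain rule: \<open>pderiv\<close> differentiates in the outer variable
  and \<open>map_poly pderiv\<close> in the inner one.\<close>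

lemma has_field_derivative_poly_poly:
  fixes Q :: "complex poly poly"
  assumes "(e has_field_derivative e') (at x)" "(\<sigma> has_field_derivative \<sigma>') (at x)"
  shows "((\<lambda>x. poly (poly Q [:e x:]) (\<sigma> x)) has_field_derivative
     (e' * poly (poly (pderiv Q) [:e x:]) (\<sigma> x)
      + \<sigma>' * poly (poly (map_poly pderiv Q) [:e x:]) (\<sigma> x))) (at x)"
proof (induction Q)
  case (pCons p Q)
  have 1: "((\<lambda>x. poly p (\<sigma> x)) has_field_derivative poly (pderiv p) (\<sigma> x) * \<sigma>') (at x)"
    by (rule DERIV_chain2[OF poly_DERIV assms(2)])
  have 2: "((\<lambda>x. poly p (\<sigma> x) + e x * poly (poly Q [:e x:]) (\<sigma> x)) has_field_derivative
     (poly (pderiv p) (\<sigma> x) * \<sigma>' + (e' * poly (poly Q [:e x:]) (\<sigma> x) +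
      (e' * poly (poly (pderiv Q) [:e x:]) (\<sigma> x)
      + \<sigma>' * poly (poly (map_poly pderiv Q) [:e x:]) (\<sigma> x)) * e x))) (at x)"
    by (rule DERIV_add[OF 1 DERIV_mult[OF assms(1) pCons.IH]])
  show ?case
    using 2 by (simp add: pderiv_pCons map_poly_pCons algebra_simps)
qed simp

text \<open>With \<epsilon> = 1 - (1 - u) s, the derivatives of \<epsilon> are -(1 - u) in
  \<open>s\<close> and \<open>s\<close> in \<open>u\<close>. Two differentiations lower the power of
  \<epsilon> by at most 2, so at \<epsilon> = 0 only coefficients up to 2 survive.\<close>

lemma second_derivs_poly_poly:
  fixes P :: "complex poly poly" and t :: complex
  defines "F \<equiv> \<lambda>u s. poly (poly P [:1 - (1 - u) * s:]) s"
  assumes "t \<noteq> 0" "coeff P 0 = 0"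
  shows "deriv (\<lambda>s. deriv (F (1 - 1 / t)) s) t
       = 2 / t\<^sup>2 * poly (coeff P 2) t - 2 / t * poly (pderiv (coeff P 1)) t"
    and "deriv (\<lambda>s. deriv (\<lambda>u. F u s) (1 - 1 / t)) t
       = poly (coeff P 1) t + t * poly (pderiv (coeff P 1)) t - 2 * poly (coeff P 2) t"
    and "deriv (\<lambda>u. deriv (\<lambda>u. F u t) u) (1 - 1 / t) = 2 * t\<^sup>2 * poly (coeff P 2) t"
proof -
  define G where "G Q u s = poly (poly Q [:1 - (1 - u) * s:]) s"
    for Q :: "complex poly poly" and u s
  let ?D = "map_poly pderiv"
  have Gs: "(G Q u has_field_derivative - (1 - u) * G (pderiv Q) u s + G (?D Q) u s) (at s)"
    for Q u s
  proof -
    have "((\<lambda>s. 1 - (1 - u) * s) has_field_derivative - (1 - u)) (at s)"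
      by (auto intro!: derivative_eq_intros)
    from has_field_derivative_poly_poly[OF this DERIV_ident] show ?thesis
      by (simp add: G_def[abs_def])
  qed
  have Gu: "((\<lambda>u. G Q u s) has_field_derivative s * G (pderiv Q) u s) (at u)" for Q u s
  proof -
    have "((\<lambda>u. 1 - (1 - u) * s) has_field_derivative s) (at u)"
      by (auto intro!: derivative_eq_intros)
    from has_field_derivative_poly_poly[OF this DERIV_const] show ?thesis
      by (simp add: G_def[abs_def])
  qed
  have FG: "F = G P" by (simp add: F_def G_def fun_eq_iff)
  \<comment> \<open>At this point \<epsilon> is 0, so evaluation picks out the constant
    coefficient.\<close>
  have G0: "G Q (1 - 1 / t) t = poly (coeff Q 0) t" for Q
    using assms(2) by (simp add: G_def poly_0_coeff_0)
  have c2: "coeff (pderiv (pderiv P)) 0 = 2 * coeff P 2"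
    and c1: "coeff (pderiv P) 0 = coeff P 1"
    and cD: "coeff (?D Q) k = pderiv (coeff Q k)" for Q :: "complex poly poly" and k
    by (simp_all add: coeff_pderiv coeff_map_poly flip: numeral_2_eq_2)
  have c1D: "coeff (pderiv (?D P)) 0 = pderiv (coeff P 1)"
    by (simp add: coeff_pderiv cD)
  let ?u = "1 - 1 / t"
  have 1: "deriv (F ?u) = (\<lambda>s. - (1 - ?u) * G (pderiv P) ?u s + G (?D P) ?u s)"
    unfolding FG by (rule ext, rule DERIV_imp_deriv[OF Gs])
  have "((\<lambda>s. - (1 - ?u) * G (pderiv P) ?u s + G (?D P) ?u s) has_field_derivative
     - (1 - ?u) * (- (1 - ?u) * G (pderiv (pderiv P)) ?u t + G (?D (pderiv P)) ?u t)
     + (- (1 - ?u) * G (pderiv (?D P)) ?u t + G (?D (?D P)) ?u t)) (at t)"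
    by (intro DERIV_add DERIV_cmult Gs)
  note this[THEN DERIV_imp_deriv, unfolded G0]
  then show "deriv (\<lambda>s. deriv (F ?u) s) t
       = 2 / t\<^sup>2 * poly (coeff P 2) t - 2 / t * poly (pderiv (coeff P 1)) t"
    unfolding 1 using assms(2)
    by (simp add: c2 c1 cD c1D assms(3) field_simps power2_eq_square del: One_nat_def)
  have Fu: "deriv (\<lambda>u. F u s) u = s * G (pderiv P) u s" for u s
    unfolding FG by (rule DERIV_imp_deriv[OF Gu])
  have "((\<lambda>s. s * G (pderiv P) ?u s) has_field_derivative
      1 * G (pderiv P) ?u t + (- (1 - ?u) * G (pderiv (pderiv P)) ?u t + G (?D (pderiv P)) ?u t) * t) (at t)"
    by (intro DERIV_mult DERIV_ident Gs)
  note this[THEN DERIV_imp_deriv, unfolded G0]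
  then show "deriv (\<lambda>s. deriv (\<lambda>u. F u s) ?u) t
       = poly (coeff P 1) t + t * poly (pderiv (coeff P 1)) t - 2 * poly (coeff P 2) t"
    unfolding Fu using assms(2) by (simp add: c2 c1 cD algebra_simps del: One_nat_def)
  have "((\<lambda>u. t * G (pderiv P) u t) has_field_derivative
      t * (t * G (pderiv (pderiv P)) ?u t)) (at ?u)"
    by (intro DERIV_cmult Gu)
  note this[THEN DERIV_imp_deriv, unfolded G0]
  then show "deriv (\<lambda>u. deriv (\<lambda>u. F u t) u) ?u = 2 * t\<^sup>2 * poly (coeff P 2) t"
    unfolding Fu by (simp add: c2 power2_eq_square)
qed

section \<open>Coefficients of the expansion in \<epsilon>\<close>

lemma zeta_det_expansion:
  assumes "simple_graph V E" "bij_betw v {..<n} V"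
  defines "\<epsilon> \<equiv> \<lambda>u s. 1 - (1 - u) * s"
  shows "zeta_det E w n v u s
       = (\<Sum>S\<in>Pow V. (\<Prod>x\<in>S. \<epsilon> u s * (2 - weighted_degree E w x * s - \<epsilon> u s))
           * (s ^ card (V - S) * det_on (V - S) (laplacian_fun E w)))"
proof -
  have fin: "finite V" using assms(1) by (simp add: simple_graph_def)
  have im: "v ` {..<n} = V" and inj: "inj_on v {..<n}" using assms(2) by (auto simp: bij_betw_def)
  let ?d = "weighted_degree E w"
  \<comment> \<open>Substituting (1 - u) s = 1 - \<epsilon> leaves \<open>s\<close> times the
    Laplacian plus a diagonal matrix divisible by \<epsilon>.\<close>
  let ?B = "\<lambda>x y. s * laplacian_fun E w x y
      + (if x = y then \<epsilon> u s * (2 - ?d x * s - \<epsilon> u s) else 0)"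
  let ?M = "1\<^sub>m n - s \<cdot>\<^sub>m weighted_matrix E w n v
          + ((1 - u) * s\<^sup>2) \<cdot>\<^sub>m (degree_matrix E w n v - (1 - u) \<cdot>\<^sub>m 1\<^sub>m n)"
  have M: "?M \<in> carrier_mat n n" by (rule carrier_matI) (simp_all add: weighted_matrix_def degree_matrix_def)
  have "zeta_det E w n v u s = det_on {..<n} (\<lambda>i j. ?M $$ (i, j))"
    unfolding zeta_det_def by (rule det_eq_det_on[OF M])
  also have "\<dots> = det_on {..<n} (\<lambda>i j. ?B (v i) (v j))"
  proof (rule det_on_cong)
    fix i j assume ij: "i \<in> {..<n}" "j \<in> {..<n}"
    then have "v i = v j \<longleftrightarrow> i = j" using inj by (auto dest: inj_onD)
    then show "?M $$ (i, j) = ?B (v i) (v j)"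
      using ij by (auto simp: weighted_matrix_def degree_matrix_def laplacian_fun_def
          arc_weight_def sym_arcs_def \<epsilon>_def algebra_simps power2_eq_square)
  qed
  also have "\<dots> = det_on V ?B"
    using det_on_image[OF _ inj, of ?B] im by simp
  also have "\<dots> = (\<Sum>S\<in>Pow V. (\<Prod>x\<in>S. \<epsilon> u s * (2 - ?d x * s - \<epsilon> u s))
           * det_on (V - S) (\<lambda>x y. s * laplacian_fun E w x y))"
    by (rule det_on_add_diag[OF fin])
  finally show ?thesis by (simp add: det_on_scale)
qed

text \<open>Matches the index pairs of the Kirchhoff index with the two-element sets
  \<open>S\<close> of the expansion.\<close>

lemma sum_card_2_eq_sum_pairs:
  fixes v :: "nat \<Rightarrow> 'b" and g :: "'b set \<Rightarrow> 'c::comm_monoid_add"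
  assumes "inj_on v {..<n}"
  shows "(\<Sum>S | S \<subseteq> v ` {..<n} \<and> card S = 2. g S) = (\<Sum>(p, q)\<in>{(p, q). p < q \<and> q < n}. g {v p, v q})"
proof -
  have "bij_betw (\<lambda>(p, q). {v p, v q}) {(p, q). p < q \<and> q < n} {S. S \<subseteq> v ` {..<n} \<and> card S = 2}"
    unfolding bij_betw_def
  proof (intro conjI equalityI subsetI)
    show "inj_on (\<lambda>(p, q). {v p, v q}) {(p, q). p < q \<and> q < n}"
    proof (rule inj_onI, clarify)
      fix p q p' q'
      assume *: "p < q" "q < n" "p' < q'" "q' < n" "{v p, v q} = {v p', v q'}"
      have "p < n" "p' < n" using less_trans[OF *(1,2)] less_trans[OF *(3,4)] .
      then have "v p = v p' \<longleftrightarrow> p = p'" "v q = v q' \<longleftrightarrow> q = q'"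
        "v p = v q' \<longleftrightarrow> p = q'" "v q = v p' \<longleftrightarrow> q = p'"
        using *(2,4) by (simp_all add: inj_on_eq_iff[OF assms])
      then show "p = p' \<and> q = q'" using * by (auto simp: doubleton_eq_iff)
    qed
  next
    fix S assume "S \<in> {S. S \<subseteq> v ` {..<n} \<and> card S = 2}"
    then obtain x y where "S = {x, y}" "x \<noteq> y" "S \<subseteq> v ` {..<n}"
      by (auto simp: card_2_iff)
    then obtain p q where pq: "p < n" "q < n" "p \<noteq> q" "S = {v p, v q}" by auto
    then have "S = (\<lambda>(p, q). {v p, v q}) (min p q, max p q)" "min p q < max p q" "max p q < n"
      by (auto simp: min_def max_def)
    then show "S \<in> (\<lambda>(p, q). {v p, v q}) ` {(p, q). p < q \<and> q < n}" by blast
  next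
    fix S assume "S \<in> (\<lambda>(p, q). {v p, v q}) ` {(p, q). p < q \<and> q < n}"
    then obtain p q where "p < q" "q < n" "S = {v p, v q}" by auto
    moreover from this have "v p \<noteq> v q" by (simp add: inj_on_eq_iff[OF assms])
    ultimately show "S \<in> {S. S \<subseteq> v ` {..<n} \<and> card S = 2}" by auto
  qed
  from sum.reindex_bij_betw[OF this, of g] show ?thesis by (simp add: case_prod_unfold)
qed

text \<open>The outer variable of this bivariate polynomial stands for \<open>\<epsilon> = 1 - (1 - u) t\<close>, the inner
  one for \<open>t\<close>.\<close>

definition zeta_poly :: "'a set \<Rightarrow> 'a set set \<Rightarrow> ('a \<times> 'a \<Rightarrow> complex) \<Rightarrow> complex poly poly" where
  "zeta_poly V E w = (\<Sum>S\<in>Pow V. monom 1 (card S) *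
     ((\<Prod>x\<in>S. [:[:2, - weighted_degree E w x:], - 1:])
      * [:monom (det_on (V - S) (laplacian_fun E w)) (card (V - S)):]))"

lemma zeta_det_eq_poly:
  assumes "simple_graph V E" "bij_betw v {..<n} V"
  shows "zeta_det E w n v u s = poly (poly (zeta_poly V E w) [:1 - (1 - u) * s:]) s"
proof -
  define e where "e = 1 - (1 - u) * s"
  have "zeta_det E w n v u s
       = (\<Sum>S\<in>Pow V. (\<Prod>x\<in>S. e * (2 - weighted_degree E w x * s - e))
           * (s ^ card (V - S) * det_on (V - S) (laplacian_fun E w)))"
    unfolding e_def by (rule zeta_det_expansion[OF assms])
  also have "\<dots> = poly (poly (zeta_poly V E w) [:e:]) s"
    by (simp add: zeta_poly_def poly_sum poly_prod poly_monom prod.distrib mult_ac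
        diff_diff_eq add.commute)
  finally show ?thesis by (simp only: e_def)
qed

text \<open>The factor \<open>monom 1 (card S)\<close> shifts degrees, so only sets with at most
  \<open>k\<close> elements matter; the guard keeps \<open>k - card S\<close> from
  truncating.\<close>

lemma coeff_zeta_poly:
  "coeff (zeta_poly V E w) k = (\<Sum>S\<in>Pow V. if k < card S then 0 else
     coeff (\<Prod>x\<in>S. [:[:2, - weighted_degree E w x:], - 1:]) (k - card S)
      * monom (det_on (V - S) (laplacian_fun E w)) (card (V - S)))"
proof -
  have "coeff (p * [:c:]) k = coeff p k * c" for p :: "complex poly poly" and c k
    by (simp add: mult.commute[of p] mult.commute[of c])
  then show ?thesis
    by (auto simp: zeta_poly_def coeff_sum coeff_monom_mult intro!: sum.cong)
qed

lemma coeff_0_zeta_poly: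
  assumes "simple_graph V E" "V \<noteq> {}"
  shows "coeff (zeta_poly V E w) 0 = 0"
  unfolding coeff_zeta_poly
proof (rule sum.neutral, safe)
  fix S assume "S \<subseteq> V"
  then have "finite S" using assms(1) by (auto simp: simple_graph_def intro: finite_subset)
  then show "(if 0 < card S then 0 else
     coeff (\<Prod>x\<in>S. [:[:2, - weighted_degree E w x:], - 1:]) (0 - card S)
      * monom (det_on (V - S) (laplacian_fun E w)) (card (V - S))) = 0"
    using det_on_laplacian_eq_0[OF assms] by auto
qed

text \<open>Only singletons contribute, since the empty product has no linear term. Their minors are
  all equal by the matrix-tree theorem, and the degrees add up to twice the total weight.\<close>

lemma coeff_1_zeta_poly:
  assumes "simple_graph V E" "symmetric_weight E w"
  shows "coeff (zeta_poly V E w) 1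
    = [:2 * of_nat (card V), - 2 * total_weight E w:] * monom (weighted_complexity V E w) (card V - 1)"
proof -
  have fin: "finite V" using assms(1) by (simp add: simple_graph_def)
  let ?K = "monom (weighted_complexity V E w) (card V - 1)"
  have "coeff (zeta_poly V E w) 1 = (\<Sum>S\<in>(\<lambda>x. {x}) ` V. if 1 < card S then 0 else
     coeff (\<Prod>x\<in>S. [:[:2, - weighted_degree E w x:], - 1:]) (1 - card S)
      * monom (det_on (V - S) (laplacian_fun E w)) (card (V - S)))"
    unfolding coeff_zeta_poly
  proof (rule sum.mono_neutral_right)
    show "\<forall>S\<in>Pow V - (\<lambda>x. {x}) ` V. (if 1 < card S then 0 else
     coeff (\<Prod>x\<in>S. [:[:2, - weighted_degree E w x:], - 1:]) (1 - card S)
      * monom (det_on (V - S) (laplacian_fun E w)) (card (V - S))) = 0"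
    proof
      fix S assume S: "S \<in> Pow V - (\<lambda>x. {x}) ` V"
      then have "finite S" using fin finite_subset by auto
      have "card S \<noteq> 1" using S by (auto simp: card_1_singleton_iff)
      then consider "S = {}" | "1 < card S" using \<open>finite S\<close> by (cases "card S = 0") auto
      then show "(if 1 < card S then 0 else
         coeff (\<Prod>x\<in>S. [:[:2, - weighted_degree E w x:], - 1:]) (1 - card S)
        * monom (det_on (V - S) (laplacian_fun E w)) (card (V - S))) = 0"
        by cases (auto simp: coeff_1)
    qed
  qed (use fin in auto)
  also have "\<dots> = (\<Sum>x\<in>V. [:2, - weighted_degree E w x:] * ?K)"
    using weighted_matrix_tree[OF assms] fin by (subst sum.reindex) auto
  also have "\<dots> = (\<Sum>x\<in>V. [:2, - weighted_degree E w x:]) * ?K"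
    by (rule sum_distrib_right[symmetric])
  also have "(\<Sum>x\<in>V. [:2, - weighted_degree E w x:]) = [:2 * of_nat (card V), - 2 * total_weight E w:]"
  proof -
    have "(\<Sum>x\<in>V. [:2, - weighted_degree E w x:])
      = [:\<Sum>x\<in>V. 2, \<Sum>x\<in>V. - weighted_degree E w x:]"
      using fin by (induction V rule: finite_induct) auto
    then show ?thesis using sum_weighted_degree[OF assms] by (simp add: sum_negf mult.commute)
  qed
  finally show ?thesis .
qed

text \<open>Pairs contribute the constant term of their product; singletons contribute the
  coefficient -1 of \<epsilon> in their single factor.\<close>

lemma coeff_2_zeta_poly:
  assumes "simple_graph V E" "symmetric_weight E w"
  shows "coeff (zeta_poly V E w) 2
    = (\<Sum>S | S \<subseteq> V \<and> card S = 2. (\<Prod>x\<in>S. [:2, - weighted_degree E w x:])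
         * monom (det_on (V - S) (laplacian_fun E w)) (card V - 2))
      - of_nat (card V) * monom (weighted_complexity V E w) (card V - 1)"
proof -
  have fin: "finite V" using assms(1) by (simp add: simple_graph_def)
  let ?K = "monom (weighted_complexity V E w) (card V - 1)"
  let ?m = "\<lambda>S. monom (det_on (V - S) (laplacian_fun E w)) (card V - 2)"
  let ?d = "weighted_degree E w"
  have "coeff (zeta_poly V E w) 2 = (\<Sum>S\<in>Pow V.
      (if card S = 1 then - ?K else 0) + (if card S = 2 then (\<Prod>x\<in>S. [:2, - ?d x:]) * ?m S else 0))"
    unfolding coeff_zeta_poly
  proof (rule sum.cong[OF refl])
    fix S assume "S \<in> Pow V"
    then have S: "S \<subseteq> V" "finite S" using fin finite_subset by auto
    have c: "card (V - S) = card V - card S" using S by (simp add: card_Diff_subset)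
    consider "S = {}" | x where "S = {x}" | "card S = 2" | "2 < card S"
    proof -
      have "card S = 0 \<or> card S = 1 \<or> card S = 2 \<or> 2 < card S" by linarith
      then show thesis using that S(2) by (auto simp: card_1_singleton_iff)
    qed
    then show "(if 2 < card S then 0 else
         coeff (\<Prod>x\<in>S. [:[:2, - ?d x:], - 1:]) (2 - card S)
        * monom (det_on (V - S) (laplacian_fun E w)) (card (V - S)))
      = (if card S = 1 then - ?K else 0) + (if card S = 2 then (\<Prod>x\<in>S. [:2, - ?d x:]) * ?m S else 0)"
    proof cases
      case 2
      then show ?thesis using S weighted_matrix_tree[OF assms, of x] c by simp
    next
      case 3
      have "coeff (\<Prod>x\<in>S. [:[:2, - ?d x:], - 1:]) 0 = (\<Prod>x\<in>S. [:2, - ?d x:])"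
        by (simp add: poly_prod flip: poly_0_coeff_0)
      then show ?thesis using 3 c by simp
    qed auto
  qed
  also have "\<dots> = (\<Sum>S | S \<subseteq> V \<and> card S = 1. - ?K)
      + (\<Sum>S | S \<subseteq> V \<and> card S = 2. (\<Prod>x\<in>S. [:2, - ?d x:]) * ?m S)"
    using fin by (simp add: sum.distrib sum.inter_filter[symmetric] Pow_def)
  also have "(\<Sum>S | S \<subseteq> V \<and> card S = 1. - ?K) = - (of_nat (card V) * ?K)"
    using n_subsets[OF fin, of 1] by simp
  finally show ?thesis by simp
qed

text \<open>The complexity cancels the denominator of the resistances, and the two sign changes from
  \<open>d t - 2\<close> to \<open>2 - d t\<close> cancel each other.\<close>

lemma kirchhoff_index_fun_eq:
  assumes "simple_graph V E" "bij_betw v {..<n} V" "weighted_complexity V E w \<noteq> 0"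
  shows "weighted_complexity V E w * kirchhoff_index_fun V E w n v t
    = (\<Sum>S | S \<subseteq> V \<and> card S = 2. (\<Prod>x\<in>S. 2 - weighted_degree E w x * t)
         * det_on (V - S) (laplacian_fun E w))"
proof -
  have im: "v ` {..<n} = V" and inj: "inj_on v {..<n}" using assms(2) by (auto simp: bij_betw_def)
  let ?d = "weighted_degree E w"
  let ?P = "{(p, q). p < q \<and> q < n}"
  have L: "weighted_laplacian E w n v \<in> carrier_mat n n"
    by (rule carrier_matI) (simp_all add: weighted_laplacian_def degree_matrix_def weighted_matrix_def)
  have entry: "weighted_laplacian E w n v $$ (i, j) = laplacian_fun E w (v i) (v j)"
    if "i < n" "j < n" for i j
    using that inj_on_eq_iff[OF inj, of i j]
    by (simp add: weighted_laplacian_def degree_matrix_def weighted_matrix_def laplacian_fun_def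
        arc_weight_def sym_arcs_def)
  have minor: "det (submatrix (weighted_laplacian E w n v) ({..<n} - {p, q}) ({..<n} - {p, q}))
      = det_on (V - {v p, v q}) (laplacian_fun E w)" if "p < q" "q < n" for p q
  proof -
    let ?I = "{..<n} - {p, q}"
    have "v ` ?I = V - {v p, v q}"
      using that im inj by (subst inj_on_image_set_diff[OF inj]) auto
    moreover have "inj_on v ?I" using inj by (rule inj_on_subset) auto
    ultimately have "det_on (V - {v p, v q}) (laplacian_fun E w)
        = det_on ?I (\<lambda>i j. laplacian_fun E w (v i) (v j))"
      using det_on_image[of ?I v "laplacian_fun E w"] by simp
    also have "\<dots> = det_on ?I (\<lambda>i j. weighted_laplacian E w n v $$ (i, j))"
      by (rule det_on_cong) (simp add: entry)
    also have "\<dots> = det (submatrix (weighted_laplacian E w n v) ?I ?I)"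
      by (rule det_submatrix_eq_det_on[OF L, symmetric]) auto
    finally show ?thesis by simp
  qed
  have "weighted_complexity V E w * kirchhoff_index_fun V E w n v t
     = (\<Sum>(p, q)\<in>?P. (?d (v p) * t - 2) * (?d (v q) * t - 2)
          * det_on (V - {v p, v q}) (laplacian_fun E w))"
    unfolding kirchhoff_index_fun_def sum_distrib_left
    using assms(3) by (intro sum.cong) (auto simp: resistance_def minor)
  also have "\<dots> = (\<Sum>(p, q)\<in>?P. (\<Prod>x\<in>{v p, v q}. 2 - ?d x * t)
          * det_on (V - {v p, v q}) (laplacian_fun E w))"
  proof (rule sum.cong[OF refl], clarify)
    fix p q assume "p < q" "q < n"
    then have "v p \<noteq> v q" by (simp add: inj_on_eq_iff[OF inj])
    then show "(?d (v p) * t - 2) * (?d (v q) * t - 2) * det_on (V - {v p, v q}) (laplacian_fun E w)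
      = (\<Prod>x\<in>{v p, v q}. 2 - ?d x * t) * det_on (V - {v p, v q}) (laplacian_fun E w)"
      by (simp add: algebra_simps)
  qed
  finally show ?thesis
    unfolding im[symmetric] sum_card_2_eq_sum_pairs[OF inj] .
qed

section \<open>Assembling the three second derivatives\<close>

theorem theorem12:
  fixes V :: "'a set" and E :: "'a set set" and w :: "'a \<times> 'a \<Rightarrow> complex"
    and n :: nat and v :: "nat \<Rightarrow> 'a" and t :: complex
  assumes "simple_graph V E" and "connected_graph V E"
    and "bij_betw v {..<n} V"
    and "symmetric_weight E w"
    and "weighted_complexity V E w \<noteq> 0"
    and "t \<noteq> 0"
  shows
    "deriv (\<lambda>s. deriv (\<lambda>s'. zeta_det E w n v (1 - 1 / t) s') s) t
       = 2 * t powi (int n - 4) * weighted_complexity V E w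
         * (kirchhoff_index_fun V E w n v t
            + of_nat n * t * (2 * total_weight E w * t - 2 * of_nat n + 1))
     \<and> deriv (\<lambda>s. deriv (\<lambda>u. zeta_det E w n v u s) (1 - 1 / t)) t
       = 2 * t powi (int n - 2) * weighted_complexity V E w
         * ((of_nat n - total_weight E w * t) * (of_nat n + 1) * t
            - kirchhoff_index_fun V E w n v t)
     \<and> deriv (\<lambda>u. deriv (\<lambda>u'. zeta_det E w n v u' t) u) (1 - 1 / t)
       = 2 * t ^ n * weighted_complexity V E w
         * (kirchhoff_index_fun V E w n v t - of_nat n * t)"
proof -
  have ne: "V \<noteq> {}" using assms(2) by (simp add: connected_graph_def)
  have fin: "finite V" using assms(1) by (simp add: simple_graph_def)
  have card: "card V = n" using bij_betw_same_card[OF assms(3)] by simp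
  then obtain m where m: "n = Suc m" using ne fin by (cases n) auto
  define P where "P = zeta_poly V E w"
  define \<kappa> where "\<kappa> = weighted_complexity V E w"
  define W where "W = total_weight E w"
  define K where "K = kirchhoff_index_fun V E w n v t"
  have P0: "coeff P 0 = 0" unfolding P_def by (rule coeff_0_zeta_poly[OF assms(1) ne])
  have P1: "coeff P 1 = [:2 * of_nat n, - 2 * W:] * monom \<kappa> m"
    using coeff_1_zeta_poly[OF assms(1,4)] by (simp add: P_def W_def \<kappa>_def card m)
  have P1t: "poly (coeff P 1) t = \<kappa> * t ^ m * (2 * of_nat n - 2 * W * t)"
    unfolding P1 by (simp add: poly_monom algebra_simps)
  \<comment> \<open>The extra factor \<open>t\<close> avoids the exponent \<open>m - 1\<close>,
    which would truncate at \<open>m = 0\<close>.\<close>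
  have "t * poly (pderiv (monom \<kappa> m)) t = of_nat m * \<kappa> * t ^ m"
    by (cases m) (simp_all add: pderiv_monom poly_monom)
  moreover have "t * poly (pderiv (coeff P 1)) t
      = (2 * of_nat n - 2 * W * t) * (t * poly (pderiv (monom \<kappa> m)) t) - 2 * W * t * (\<kappa> * t ^ m)"
    unfolding P1 pderiv_mult by (simp add: pderiv_pCons poly_monom algebra_simps)
  ultimately have P1't: "t * poly (pderiv (coeff P 1)) t
      = \<kappa> * t ^ m * (of_nat m * (2 * of_nat n - 2 * W * t) - 2 * W * t)"
    by (simp add: algebra_simps)
  have "t * poly (coeff P 2) t = (\<Sum>S | S \<subseteq> V \<and> card S = 2. (\<Prod>x\<in>S. 2 - weighted_degree E w x * t)
         * det_on (V - S) (laplacian_fun E w) * t ^ m) - of_nat n * \<kappa> * t ^ m * t"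
  proof -
    \<comment> \<open>A two-element \<open>S\<close> forces \<open>n\<close> to be at least 2, so
      the subtraction is exact; for \<open>n = 1\<close> the sum is empty.\<close>
    have pow: "t * t ^ (card V - 2) = t ^ m" if "S \<subseteq> V" "card S = 2" for S
    proof -
      have "2 \<le> n" using card_mono[OF fin that(1)] that(2) card by simp
      then show ?thesis by (simp add: card m flip: power_Suc)
    qed
    have "t * poly (coeff P 2) t = (\<Sum>S | S \<subseteq> V \<and> card S = 2.
        t * ((\<Prod>x\<in>S. 2 - weighted_degree E w x * t) * (det_on (V - S) (laplacian_fun E w) * t ^ (card V - 2))))
        - of_nat n * \<kappa> * t ^ m * t"
      unfolding P_def coeff_2_zeta_poly[OF assms(1,4)]
      by (simp add: poly_sum poly_prod poly_monom card m \<kappa>_def algebra_simps sum_distrib_left)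
    also have "(\<Sum>S | S \<subseteq> V \<and> card S = 2.
        t * ((\<Prod>x\<in>S. 2 - weighted_degree E w x * t) * (det_on (V - S) (laplacian_fun E w) * t ^ (card V - 2))))
      = (\<Sum>S | S \<subseteq> V \<and> card S = 2. (\<Prod>x\<in>S. 2 - weighted_degree E w x * t)
         * det_on (V - S) (laplacian_fun E w) * t ^ m)"
      by (rule sum.cong[OF refl]) (auto simp: pow[symmetric] mult_ac)
    finally show ?thesis .
  qed
  also have "\<dots> = \<kappa> * K * t ^ m - of_nat n * \<kappa> * t ^ m * t"
    unfolding K_def \<kappa>_def kirchhoff_index_fun_eq[OF assms(1,3,5)] sum_distrib_right ..
  finally have P2t: "t * poly (coeff P 2) t = \<kappa> * t ^ m * (K - of_nat n * t)"
    by (simp add: algebra_simps)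
  \<comment> \<open>These exponents may be negative, so the integer powers become quotients of
    natural powers.\<close>
  have n4: "t powi (int n - 4) = t ^ m / t ^ 3" and n2: "t powi (int n - 2) = t ^ m / t"
  proof -
    have "t powi (int n - 4) = t powi (int m - 3)" "t powi (int n - 2) = t powi (int m - 1)"
      by (simp_all add: m)
    then show "t powi (int n - 4) = t ^ m / t ^ 3" "t powi (int n - 2) = t ^ m / t"
      using assms(6) by (simp_all add: power_int_diff power3_eq_cube)
  qed
  have zeta: "zeta_det E w n v = (\<lambda>u s. poly (poly P [:1 - (1 - u) * s:]) s)"
    by (intro ext) (simp add: P_def zeta_det_eq_poly[OF assms(1,3)])
  have P1'q: "poly (pderiv (coeff P 1)) t
      = \<kappa> * t ^ m * (of_nat m * (2 * of_nat n - 2 * W * t) - 2 * W * t) / t"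
    and P2q: "poly (coeff P 2) t = \<kappa> * t ^ m * (K - of_nat n * t) / t"
    using P1't P2t assms(6) by (simp_all add: field_simps)
  have nm: "of_nat n = (of_nat m + 1 :: complex)" by (simp add: m)
  show ?thesis
    unfolding zeta second_derivs_poly_poly[OF assms(6) P0] P1t P1'q P2q n4 n2
      K_def[symmetric] \<kappa>_def[symmetric] W_def[symmetric]
  proof (intro conjI)
    show "2 / t\<^sup>2 * (\<kappa> * t ^ m * (K - of_nat n * t) / t)
       - 2 / t * (\<kappa> * t ^ m * (of_nat m * (2 * of_nat n - 2 * W * t) - 2 * W * t) / t)
      = 2 * (t ^ m / t ^ 3) * \<kappa> * (K + of_nat n * t * (2 * W * t - 2 * of_nat n + 1))"
      unfolding nm using assms(6) by (simp add: field_simps power2_eq_square power3_eq_cube)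
    show "\<kappa> * t ^ m * (2 * of_nat n - 2 * W * t)
       + t * (\<kappa> * t ^ m * (of_nat m * (2 * of_nat n - 2 * W * t) - 2 * W * t) / t)
       - 2 * (\<kappa> * t ^ m * (K - of_nat n * t) / t)
      = 2 * (t ^ m / t) * \<kappa> * ((of_nat n - W * t) * (of_nat n + 1) * t - K)"
      unfolding nm using assms(6) by (simp add: field_simps)
    show "2 * t\<^sup>2 * (\<kappa> * t ^ m * (K - of_nat n * t) / t) = 2 * t ^ n * \<kappa> * (K - of_nat n * t)"
      using assms(6) by (simp add: m power2_eq_square)
  qed
qed

end
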